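(* Suppose that for each sign $\nu\in\{+,-\}$ the coefficients satisfy $\alpha_0^\nu\ge 0$, $\alpha_0^\nu+|\beta_0^\nu|>0$, $\nu\beta_0^\nu\ge 0$ (that is, $\beta_0^+\ge 0$ and $\beta_0^-\le 0$), and $$\left(\frac{\sum_{i=1}^{m^\nu}|\alpha_i^\nu|}{\alpha_0^\nu}\right)^2+\left(\frac{\sum_{i=1}^{m^\nu}|\beta_i^\nu|}{\beta_0^\nu}\right)^2<1,$$ with the convention that if a denominator is zero then the corresponding numerator must also be zero and the corresponding fraction is omitted. Suppose also that $\alpha_0^-+\alpha_0^+>0$. Then, for each $k\ge 0$, the algebraic multiplicity of the characteristic value $\lambda_k$ of $-\Delta_Y^{-1}$ is equal to $1$, that is, $$\dim\bigcup_{j=1}^\infty N\big((I_Y+\lambda_k\Delta_Y^{-1})^j\big)=1 .$$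
   Context: Data: integers $m^\pm\ge 1$; for each sign $\nu\in\{+,-\}$, numbers $\alpha_0^\nu,\beta_0^\nu\in\mathbb{R}$, $\alpha_i^\nu,\beta_i^\nu\in\mathbb{R}$ and $\eta_i^\nu\in[-1,1]$, $i=1,\dots,m^\nu$, with $\eta_i^+\ne 1$ and $\eta_i^-\neq -1$. The boundary conditions are $$(\ast)\qquad \alpha_0^\pm u(\pm1)+\beta_0^\pm u'(\pm 1)=\sum_{i=1}^{m^\pm}\alpha_i^\pm u(\eta_i^\pm)+\sum_{i=1}^{m^\pm}\beta_i^\pm u'(\eta_i^\pm)$$ (one for each sign). Let $X=\{u\in C^2[-1,1]: u\text{ satisfies }(\ast)\}$ with the $C^2$ norm, $Y=C^0[-1,1]$ with the sup norm (real-valued functions), and $\Delta:X\to Y$, $\Delta u=u''$. Under the hypotheses of the claim $\Delta$ has a bounded inverse; $\Delta_Y^{-1}:Y\to Y$ denotes this inverse regarded as a (compact) operator from $Y$ into itself, $I_Y$ is the identity on $Y$ and $N$ denotes null-space. The eigenvalues are the real $\lambda$ for which $-\Delta u=\lambda u$ has a non-trivial solution $u\in X$; under the hypotheses of the claim they form a strictly increasing sequence $0<\lambda_0<\lambda_1<\cdots$ tending to $\infty$, and are the characteristic values of $-\Delta_Y^{-1}$. *)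

theory Defs
  imports "HOL-Analysis.Analysis"
begin

text \<open>
  The compact interval $[-1,1]$ as a metric space of its own, so that $C^0[-1,1]$ with the sup norm
  is the library's Banach space of bounded continuous functions on it.
\<close>

typedef I11 = "{-1..1::real}"
  by (rule exI[of _ 0]) simp

instantiation I11 :: metric_space
begin

definition dist_I11 :: "I11 \<Rightarrow> I11 \<Rightarrow> real"
  where "dist_I11 s t = dist (Rep_I11 s) (Rep_I11 t)"

definition uniformity_I11 :: "(I11 \<times> I11) filter"
  where "uniformity_I11 = (INF e\<in>{0<..}. principal {(s, t). dist s t < e})"

definition open_I11 :: "I11 set \<Rightarrow> bool"
  where "open_I11 U = (\<forall>s\<in>U. eventually (\<lambda>(s', t). s' = s \<longrightarrow> t \<in> U) uniformity)"

instance
proof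
  fix s t r :: I11
  show "(dist s t = 0) = (s = t)"
    by (simp add: dist_I11_def Rep_I11_inject)
  show "dist s t \<le> dist s r + dist t r"
    by (simp add: dist_I11_def dist_triangle2)
qed (simp_all only: uniformity_I11_def open_I11_def)

end

type_synonym C0 = "I11 \<Rightarrow>\<^sub>C real"

text \<open>A function on the interval, read as a function of a real variable; only its values on
  $[-1,1]$ are meaningful.\<close>

definition on_real :: "C0 \<Rightarrow> real \<Rightarrow> real"
  where "on_real u x = apply_bcontfun u (Abs_I11 x)"

lemma continuous_on_Rep_I11: "continuous_on S Rep_I11"
  by (auto simp: continuous_on_iff dist_I11_def)

lemma continuous_on_Abs_I11: "continuous_on {-1..1} Abs_I11"
  by (auto simp: continuous_on_iff dist_I11_def Abs_I11_inverse)

lemma compact_UNIV_I11: "compact (UNIV :: I11 set)"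
proof -
  have "compact (Abs_I11 ` {-1..1})"
    by (rule compact_continuous_image[OF continuous_on_Abs_I11]) simp
  moreover have "Abs_I11 ` {-1..1} = UNIV"
    by (metis Abs_I11_cases UNIV_eq_I image_eqI)
  ultimately show ?thesis by simp
qed

text \<open>Nothing is lost by the boundedness built into the function type: restriction to the
  interval maps every continuous function on $[-1,1]$ to an element of \<open>C0\<close>, and conversely.\<close>

lemma continuous_on_real: "continuous_on {-1..1} (on_real u)"
proof -
  have "continuous_on UNIV (apply_bcontfun u)"
    using apply_bcontfun[of u] by (simp add: bcontfun_def)
  then show ?thesis
    unfolding on_real_def
    by (rule continuous_on_compose2[OF _ continuous_on_Abs_I11]) simp
qed

lemma on_real_Bcontfun:
  assumes "continuous_on {-1..1} f" "x \<in> {-1..1}"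
  shows "on_real (Bcontfun (\<lambda>t. f (Rep_I11 t))) x = f x"
proof -
  have c: "continuous_on UNIV (\<lambda>t. f (Rep_I11 t))"
    by (rule continuous_on_compose2[OF assms(1) continuous_on_Rep_I11]) (use Rep_I11 in auto)
  then have "bounded (range (\<lambda>t. f (Rep_I11 t)))"
    by (intro compact_imp_bounded compact_continuous_image compact_UNIV_I11)
  with c have "(\<lambda>t. f (Rep_I11 t)) \<in> bcontfun"
    by (simp add: bcontfun_def)
  then show ?thesis
    using assms(2) by (simp add: on_real_def Bcontfun_inverse Abs_I11_inverse)
qed

text \<open>Derivatives are relative to $[-1,1]$, hence one-sided at the end points.\<close>

definition D1 :: "C0 \<Rightarrow> real \<Rightarrow> real"
  where "D1 u x = vector_derivative (on_real u) (at x within {-1..1})"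

definition D2 :: "C0 \<Rightarrow> real \<Rightarrow> real"
  where "D2 u x = vector_derivative (D1 u) (at x within {-1..1})"

definition C2 :: "C0 set"
  where "C2 = {u. on_real u differentiable_on {-1..1} \<and> D1 u differentiable_on {-1..1} \<and>
                  continuous_on {-1..1} (D2 u)}"

datatype sign = Minus | Plus

fun sgn_val :: "sign \<Rightarrow> real"
  where
    "sgn_val Minus = -1"
  | "sgn_val Plus = 1"

text \<open>
  Field \<open>npts\<close> holds the numbers $m^\pm$. Index 0 of \<open>alpha\<close> and \<open>beta\<close> is the coefficient at the
  end point, indices $1,\dots,m^\nu$ belong to the points \<open>eta\<close>; other indices are never used.
\<close>

record bc_data =
  npts :: "sign \<Rightarrow> nat"
  alpha :: "sign \<Rightarrow> nat \<Rightarrow> real"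
  beta :: "sign \<Rightarrow> nat \<Rightarrow> real"
  eta :: "sign \<Rightarrow> nat \<Rightarrow> real"

definition valid_bc :: "bc_data \<Rightarrow> bool"
  where "valid_bc B \<longleftrightarrow> (\<forall>\<nu>. npts B \<nu> \<ge> 1 \<and>
           (\<forall>i\<in>{1..npts B \<nu>}. eta B \<nu> i \<in> {-1..1} \<and> eta B \<nu> i \<noteq> sgn_val \<nu>))"

definition satisfies_bc :: "bc_data \<Rightarrow> C0 \<Rightarrow> bool"
  where "satisfies_bc B u \<longleftrightarrow> (\<forall>\<nu>.
           alpha B \<nu> 0 * on_real u (sgn_val \<nu>) + beta B \<nu> 0 * D1 u (sgn_val \<nu>) =
           (\<Sum>i = 1..npts B \<nu>. alpha B \<nu> i * on_real u (eta B \<nu> i)) +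
           (\<Sum>i = 1..npts B \<nu>. beta B \<nu> i * D1 u (eta B \<nu> i)))"

definition X_bc :: "bc_data \<Rightarrow> C0 set"
  where "X_bc B = {u \<in> C2. satisfies_bc B u}"

definition Laplacian :: "C0 \<Rightarrow> C0"
  where "Laplacian u = Bcontfun (\<lambda>t. D2 u (Rep_I11 t))"

definition Laplacian_inv :: "bc_data \<Rightarrow> C0 \<Rightarrow> C0"
  where "Laplacian_inv B = inv_into (X_bc B) Laplacian"

definition eigenvalues :: "bc_data \<Rightarrow> real set"
  where "eigenvalues B = {\<mu>. \<exists>u\<in>X_bc B. u \<noteq> 0 \<and> - Laplacian u = \<mu> *\<^sub>R u}"

definition null_space :: "(C0 \<Rightarrow> C0) \<Rightarrow> C0 set"
  where "null_space A = {v. A v = 0}"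

text \<open>
  The smallness condition for one sign. Division by zero yields zero, so a fraction with zero
  denominator is omitted automatically; only its numerator has to be forced to vanish.
\<close>

definition small_coeffs :: "bc_data \<Rightarrow> sign \<Rightarrow> bool"
  where "small_coeffs B \<nu> \<longleftrightarrow>
           (alpha B \<nu> 0 = 0 \<longrightarrow> (\<Sum>i = 1..npts B \<nu>. \<bar>alpha B \<nu> i\<bar>) = 0) \<and>
           (beta B \<nu> 0 = 0 \<longrightarrow> (\<Sum>i = 1..npts B \<nu>. \<bar>beta B \<nu> i\<bar>) = 0) \<and>
           ((\<Sum>i = 1..npts B \<nu>. \<bar>alpha B \<nu> i\<bar>) / alpha B \<nu> 0)\<^sup>2 +
           ((\<Sum>i = 1..npts B \<nu>. \<bar>beta B \<nu> i\<bar>) / beta B \<nu> 0)\<^sup>2 < 1"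

end

theory Submission
  imports Defs
begin

text \<open>
  Write $T = \Delta_Y^{-1}$ and let $\varphi$ be an eigenfunction for $\lambda$. If
  $(I + \lambda T) v = c\varphi$, then $v = c\varphi - \lambda T v$ lies in $X$ and solves
  $v'' + \lambda v = -\lambda c\varphi$. By induction on the exponent, every null space
  $N((I + \lambda T)^j)$ is therefore contained in the line through $\varphi$ as soon as this
  one fact is known: a solution $v \in X$ of $v'' + \lambda v = c\varphi$, with any $c$, is a
  multiple of $\varphi$ (\<open>resonance_in_span\<close>). It contains the geometric simplicity ($c = 0$)
  and the absence of generalised eigenvectors.

  To prove it, put $\lambda = s^2 > 0$. The solutions of $v'' + \lambda v = c\varphi$ are
  $a\varphi + \ell\varphi'$ with $\ell$ affine (\<open>resonant_oscillator\<close>), so by linearity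
  $w = \ell\varphi'$ satisfies both boundary conditions, as $\varphi$ does. If $\ell \neq 0$,
  consider the end point where $|\ell|$ is largest. The pair $(s\varphi, \varphi')$ moves on a
  circle, because the energy $\varphi'^2 + \lambda\varphi^2$ is constant. The conditions on
  $\varphi$ and on $w$ at that end point are two real equations for the position of the pair there;
  solved for that position, they express it through the positions at the points $\eta_i$. The
  smallness of the coefficients then puts it strictly inside the circle
  (\<open>rotating_pair_contradiction\<close>). The signs of $\alpha_0$ and $\beta_0$ enter because the
  logarithmic slope of $\ell$ at the chosen end point has the sign of that end point, unless it is zero.

  Two further facts are needed: $\lambda > 0$, and $\Delta : X \to Y$ is bijective, for otherwise
  \<open>Laplacian_inv\<close> would take arbitrary values. Both follow from one maximum principle
  (\<open>nonpositive_no_eigenfunction\<close>): for $\lambda \le 0$ the square of a solution of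
  $u'' = -\lambda u$ is convex, and constancy of the energy makes $|u|$ and $|u'|$ attain their
  maxima at the same end point, where the boundary condition forces $u$ to vanish
  (or, if $\alpha_0 = 0$ there, to be a constant that the other condition forbids).
  Injectivity of $\Delta$ is the case $\lambda = 0$, and surjectivity reduces to injectivity of a
  linear map of the plane.
\<close>

section \<open>Twice differentiable functions on the interval\<close>

definition deriv_on_I :: "(real \<Rightarrow> real) \<Rightarrow> (real \<Rightarrow> real) \<Rightarrow> bool"
  where "deriv_on_I f f' \<longleftrightarrow>
    (\<forall>x\<in>{-1..1}. (f has_real_derivative f' x) (at x within {-1..1}))"

lemma deriv_on_ID:
  "deriv_on_I f f' \<Longrightarrow> x \<in> {-1..1} \<Longrightarrow> (f has_real_derivative f' x) (at x within {-1..1})"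
  by (simp add: deriv_on_I_def)

lemma deriv_on_I_continuous: "deriv_on_I f f' \<Longrightarrow> continuous_on {-1..1} f"
  unfolding deriv_on_I_def by (rule DERIV_continuous_on) blast

lemma deriv_on_I_cong:
  assumes "deriv_on_I f f'" "\<And>x. x \<in> {-1..1} \<Longrightarrow> g x = f x"
    "\<And>x. x \<in> {-1..1} \<Longrightarrow> g' x = f' x"
  shows "deriv_on_I g g'"
  unfolding deriv_on_I_def
proof
  fix x :: real assume x: "x \<in> {-1..1}"
  from deriv_on_ID[OF assms(1) x]
  have "(g has_real_derivative f' x) (at x within {-1..1})"
    by (rule has_field_derivative_transform_within[OF _ zero_less_one x]) (simp add: assms(2))
  then show "(g has_real_derivative g' x) (at x within {-1..1})"
    using assms(3)[OF x] by simp
qed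

lemma deriv_on_I_interior:
  assumes "deriv_on_I f f'" "-1 < x" "x < 1"
  shows "(f has_real_derivative f' x) (at x)"
proof -
  have "at x within {-1..1} = at x"
    using assms by (intro at_within_interior) auto
  then show ?thesis
    using deriv_on_ID[OF assms(1), of x] assms by simp
qed

lemma deriv_on_I_mvt:
  assumes f: "deriv_on_I f f'" and "-1 \<le> x" "x < y" "y \<le> 1"
  obtains z where "x < z" "z < y" "f y - f x = (y - x) * f' z"
proof -
  have d: "(f has_real_derivative f' z) (at z)" if "x < z" "z < y" for z
    using deriv_on_I_interior[OF f] that assms by auto
  have "continuous_on {x..y} f"
    by (rule continuous_on_subset[OF deriv_on_I_continuous[OF f]]) (use assms in auto)
  then obtain l z where "x < z" "z < y" "(f has_real_derivative l) (at z)" "f y - f x = (y - x) * l"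
    using MVT[OF \<open>x < y\<close>] d real_differentiable_def by metis
  then show ?thesis using that d DERIV_unique by metis
qed

lemma deriv_on_I_nonneg_mono:
  assumes f: "deriv_on_I f f'" and nonneg: "\<And>x. x \<in> {-1..1} \<Longrightarrow> f' x \<ge> 0"
    and xy: "-1 \<le> x" "x \<le> y" "y \<le> 1"
  shows "f x \<le> f y"
proof (cases "x = y")
  case False
  then obtain z where "x < z" "z < y" "f y - f x = (y - x) * f' z"
    using deriv_on_I_mvt[OF f, of x y] xy by auto
  moreover have "(y - x) * f' z \<ge> 0"
    using nonneg[of z] calculation xy by auto
  ultimately show ?thesis by simp
qed simp

lemma vector_derivative_deriv_on_I:
  assumes "deriv_on_I f f'" "x \<in> {-1..1}"
  shows "vector_derivative f (at x within {-1..1}) = f' x"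
  using assms
  by (intro vector_derivative_within_closed_interval)
     (auto simp: deriv_on_I_def has_real_derivative_iff_has_vector_derivative)

lemma antiderivative_on_I:
  assumes "continuous_on {-1..1} f"
  obtains F where "deriv_on_I F f"
proof -
  obtain F where "\<And>x. x \<in> {-1..1} \<Longrightarrow> (F has_vector_derivative f x) (at x within {-1..1})"
    using antiderivative_continuous[OF assms] by blast
  then show ?thesis
    using that[of F] by (simp add: deriv_on_I_def has_real_derivative_iff_has_vector_derivative)
qed

lemma C2_derivs:
  assumes "u \<in> C2"
  shows "deriv_on_I (on_real u) (D1 u)" "deriv_on_I (D1 u) (D2 u)"
  using assms
  unfolding C2_def deriv_on_I_def has_real_derivative_iff_has_vector_derivative D1_def D2_def
  by (auto simp: differentiable_on_def vector_derivative_works)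

lemma C2_intro:
  assumes "deriv_on_I (on_real u) u1" "deriv_on_I u1 u2" "continuous_on {-1..1} u2"
  shows "u \<in> C2" "\<And>x. x \<in> {-1..1} \<Longrightarrow> D1 u x = u1 x" "\<And>x. x \<in> {-1..1} \<Longrightarrow> D2 u x = u2 x"
proof -
  show 1: "D1 u x = u1 x" if "x \<in> {-1..1}" for x
    unfolding D1_def by (rule vector_derivative_deriv_on_I[OF assms(1) that])
  have d: "deriv_on_I (D1 u) u2"
    by (rule deriv_on_I_cong[OF assms(2) 1 refl])
  show 2: "D2 u x = u2 x" if "x \<in> {-1..1}" for x
    unfolding D2_def by (rule vector_derivative_deriv_on_I[OF d that])
  have diff: "f differentiable_on {-1..1}" if "deriv_on_I f f'" for f f'
    using that by (auto simp: differentiable_on_def deriv_on_I_def differentiable_def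
        has_field_derivative_def)
  show "u \<in> C2"
    unfolding C2_def using diff[OF assms(1)] diff[OF d]
      continuous_on_eq[OF assms(3) 2[symmetric]] by simp
qed

lemma on_real_lincomb: "on_real (a *\<^sub>R u + b *\<^sub>R v) x = a * on_real u x + b * on_real v x"
  by (simp add: on_real_def)

lemma on_real_eqI: "(\<And>x. x \<in> {-1..1} \<Longrightarrow> on_real u x = on_real v x) \<Longrightarrow> u = v"
  by (rule bcontfun_eqI) (metis Rep_I11 Rep_I11_inverse on_real_def)

lemma C2_lincomb:
  assumes u: "u \<in> C2" and v: "v \<in> C2"
  shows "a *\<^sub>R u + b *\<^sub>R v \<in> C2"
    "\<And>x. x \<in> {-1..1} \<Longrightarrow> D1 (a *\<^sub>R u + b *\<^sub>R v) x = a * D1 u x + b * D1 v x"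
    "\<And>x. x \<in> {-1..1} \<Longrightarrow> D2 (a *\<^sub>R u + b *\<^sub>R v) x = a * D2 u x + b * D2 v x"
proof -
  have 1: "deriv_on_I (on_real (a *\<^sub>R u + b *\<^sub>R v)) (\<lambda>x. a * D1 u x + b * D1 v x)"
    using C2_derivs(1)[OF u] C2_derivs(1)[OF v]
    unfolding deriv_on_I_def on_real_lincomb by (auto intro!: derivative_eq_intros)
  have 2: "deriv_on_I (\<lambda>x. a * D1 u x + b * D1 v x) (\<lambda>x. a * D2 u x + b * D2 v x)"
    using C2_derivs(2)[OF u] C2_derivs(2)[OF v]
    unfolding deriv_on_I_def by (auto intro!: derivative_eq_intros)
  have 3: "continuous_on {-1..1} (\<lambda>x. a * D2 u x + b * D2 v x)"
    using u v unfolding C2_def by (auto intro!: continuous_intros)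
  note C2_intro[OF 1 2 3]
  then show "a *\<^sub>R u + b *\<^sub>R v \<in> C2"
    "\<And>x. x \<in> {-1..1} \<Longrightarrow> D1 (a *\<^sub>R u + b *\<^sub>R v) x = a * D1 u x + b * D1 v x"
    "\<And>x. x \<in> {-1..1} \<Longrightarrow> D2 (a *\<^sub>R u + b *\<^sub>R v) x = a * D2 u x + b * D2 v x"
    by blast+
qed

lemma Laplacian_eq_iff:
  assumes "u \<in> C2"
  shows "Laplacian u = v \<longleftrightarrow> (\<forall>x\<in>{-1..1}. D2 u x = on_real v x)"
proof -
  have "on_real (Laplacian u) x = D2 u x" if "x \<in> {-1..1}" for x
    unfolding Laplacian_def using assms that by (simp add: on_real_Bcontfun C2_def)
  then show ?thesis
    by (metis on_real_eqI)
qed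

section \<open>Linear oscillators\<close>

lemma oscillator_energy_constant:
  assumes "deriv_on_I u u1" "deriv_on_I u1 (\<lambda>x. - \<mu> * u x)" "x \<in> {-1..1}" "y \<in> {-1..1}"
  shows "(u1 x)\<^sup>2 + \<mu> * (u x)\<^sup>2 = (u1 y)\<^sup>2 + \<mu> * (u y)\<^sup>2"
proof -
  have "((\<lambda>x. (u1 x)\<^sup>2 + \<mu> * (u x)\<^sup>2) has_real_derivative 0) (at x within {-1..1})"
    if "x \<in> {-1..1}" for x
    using assms(1,2) that unfolding deriv_on_I_def
    by (auto intro!: derivative_eq_intros)
  then have "\<exists>c. \<forall>x\<in>{-1..1}. (u1 x)\<^sup>2 + \<mu> * (u x)\<^sup>2 = c"
    by (intro has_field_derivative_zero_constant) auto
  then show ?thesis using assms(3,4) by auto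
qed

text \<open>Uniqueness for the initial value problem at 0, read off from the energy, which is a definite
  form for positive \<open>\<mu>\<close>.\<close>

lemma oscillator_zero:
  assumes "\<mu> > 0" "deriv_on_I u u1" "deriv_on_I u1 (\<lambda>x. - \<mu> * u x)" "u 0 = 0" "u1 0 = 0"
    "x \<in> {-1..1}"
  shows "u x = 0" "u1 x = 0"
proof -
  have e: "(u1 x)\<^sup>2 + \<mu> * (u x)\<^sup>2 = 0"
    using oscillator_energy_constant[OF assms(2,3,6), of 0] assms(4,5) by simp
  have "(u1 x)\<^sup>2 \<ge> 0" "\<mu> * (u x)\<^sup>2 \<ge> 0" using assms(1) by auto
  with e have "(u1 x)\<^sup>2 = 0" "\<mu> * (u x)\<^sup>2 = 0" by linarith+
  then show "u x = 0" "u1 x = 0" using assms(1) by auto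
qed

text \<open>Since $(x\varphi')'' + \mu x\varphi' = 2\varphi'' = -2\mu\varphi$, a suitable multiple of
  $x\varphi'$ is a particular solution. The homogeneous solutions $\varphi$ and $\varphi'$ have a
  Wronskian equal, up to sign, to the energy of $\varphi$, so they can match the initial values
  at 0, and \<open>oscillator_zero\<close> applies to the difference.\<close>

lemma resonant_oscillator:
  assumes lam: "\<mu> > 0"
    and phi: "deriv_on_I \<phi> \<phi>1" "deriv_on_I \<phi>1 (\<lambda>x. - \<mu> * \<phi> x)"
    and nz: "(\<phi>1 0)\<^sup>2 + \<mu> * (\<phi> 0)\<^sup>2 \<noteq> 0"
    and u: "deriv_on_I u u1" "deriv_on_I u1 (\<lambda>x. - \<mu> * u x + c * \<phi> x)"
  obtains a p q where
    "\<And>x. x \<in> {-1..1} \<Longrightarrow> u x = a * \<phi> x + (p + q * x) * \<phi>1 x"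
    "\<And>x. x \<in> {-1..1} \<Longrightarrow> u1 x = a * \<phi>1 x + (q * \<phi>1 x - \<mu> * (p + q * x) * \<phi> x)"
proof -
  define q where "q = - c / (2 * \<mu>)"
  define E where "E = (\<phi>1 0)\<^sup>2 + \<mu> * (\<phi> 0)\<^sup>2"
  define r where "r = u1 0 - q * \<phi>1 0"
  \<comment> \<open>Cramer's rule for the initial values; the determinant of the system is \<open>- E\<close>.\<close>
  define a where "a = (\<mu> * u 0 * \<phi> 0 + r * \<phi>1 0) / E"
  define p where "p = (u 0 * \<phi>1 0 - r * \<phi> 0) / E"
  define z where "z x = u x - (a * \<phi> x + (p + q * x) * \<phi>1 x)" for x
  define z1 where "z1 x = u1 x - (a * \<phi>1 x + (q * \<phi>1 x - \<mu> * (p + q * x) * \<phi> x))" for x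
  have c: "c = - 2 * \<mu> * q" using lam by (simp add: q_def)
  have "deriv_on_I z z1"
    using phi u unfolding deriv_on_I_def z_def z1_def
    by (auto intro!: derivative_eq_intros simp: algebra_simps)
  moreover have "deriv_on_I z1 (\<lambda>x. - \<mu> * z x)"
    using phi u unfolding deriv_on_I_def z_def z1_def c
    by (auto intro!: derivative_eq_intros simp: algebra_simps)
  moreover have E: "E \<noteq> 0" using nz by (simp add: E_def)
  have "u 0 * E = \<mu> * u 0 * \<phi> 0 * \<phi> 0 + u 0 * \<phi>1 0 * \<phi>1 0"
    "r * E = r * \<phi>1 0 * \<phi>1 0 + \<mu> * r * \<phi> 0 * \<phi> 0"
    by (simp_all add: E_def power2_eq_square algebra_simps)
  with E have "u 0 = a * \<phi> 0 + p * \<phi>1 0" "r = a * \<phi>1 0 - \<mu> * p * \<phi> 0"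
    by (simp_all add: a_def p_def field_simps)
  then have "z 0 = 0" "z1 0 = 0"
    by (simp_all add: z_def z1_def r_def)
  ultimately have "z x = 0" "z1 x = 0" if "x \<in> {-1..1}" for x
    using oscillator_zero[OF lam _ _ _ _ that, of z z1] by auto
  then show ?thesis
    using that[of a p q] by (auto simp: z_def z1_def)
qed

section \<open>Boundary functionals\<close>

text \<open>The derivative is a separate argument so that the functional is linear in the pair \<open>(f, f1)\<close>
  and applies to pairs that are known only by formulas on the interval.\<close>

definition bc_defect :: "bc_data \<Rightarrow> sign \<Rightarrow> (real \<Rightarrow> real) \<Rightarrow> (real \<Rightarrow> real) \<Rightarrow> real"
  where "bc_defect B \<nu> f f1 =
    alpha B \<nu> 0 * f (sgn_val \<nu>) + beta B \<nu> 0 * f1 (sgn_val \<nu>) -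
    (\<Sum>i = 1..npts B \<nu>. alpha B \<nu> i * f (eta B \<nu> i)) -
    (\<Sum>i = 1..npts B \<nu>. beta B \<nu> i * f1 (eta B \<nu> i))"

lemma satisfies_bc_iff: "satisfies_bc B u \<longleftrightarrow> (\<forall>\<nu>. bc_defect B \<nu> (on_real u) (D1 u) = 0)"
  unfolding satisfies_bc_def bc_defect_def by (simp add: algebra_simps)

lemma sgn_val_in: "sgn_val \<nu> \<in> {-1..1}"
  by (cases \<nu>) auto

lemma bc_defect_lincomb:
  "bc_defect B \<nu> (\<lambda>x. a * f x + b * g x) (\<lambda>x. a * f1 x + b * g1 x) =
    a * bc_defect B \<nu> f f1 + b * bc_defect B \<nu> g g1"
  unfolding bc_defect_def by (simp add: algebra_simps sum.distrib sum_distrib_left)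

lemma bc_defect_cong:
  assumes "valid_bc B" "\<And>x. x \<in> {-1..1} \<Longrightarrow> f x = g x" "\<And>x. x \<in> {-1..1} \<Longrightarrow> f1 x = g1 x"
  shows "bc_defect B \<nu> f f1 = bc_defect B \<nu> g g1"
proof -
  have "eta B \<nu> i \<in> {-1..1}" if "i \<in> {1..npts B \<nu>}" for i
    using assms(1) that unfolding valid_bc_def by blast
  then have "f (eta B \<nu> i) = g (eta B \<nu> i)" "f1 (eta B \<nu> i) = g1 (eta B \<nu> i)"
    if "i \<in> {1..npts B \<nu>}" for i
    using assms(2,3) that by blast+
  then show ?thesis
    unfolding bc_defect_def using assms(2,3)[OF sgn_val_in] by simp
qed

text \<open>Products instead of quotients: a vanishing coefficient at the end point then needs no case
  distinction, since the convention on zero denominators makes the sum vanish with it.\<close>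

lemma small_coeffsE:
  assumes "small_coeffs B \<nu>"
  obtains P Q where "P \<ge> 0" "Q \<ge> 0" "P\<^sup>2 + Q\<^sup>2 < 1"
    "(\<Sum>i = 1..npts B \<nu>. \<bar>alpha B \<nu> i\<bar>) = P * \<bar>alpha B \<nu> 0\<bar>"
    "(\<Sum>i = 1..npts B \<nu>. \<bar>beta B \<nu> i\<bar>) = Q * \<bar>beta B \<nu> 0\<bar>"
proof
  let ?a = "\<Sum>i = 1..npts B \<nu>. \<bar>alpha B \<nu> i\<bar>" and ?b = "\<Sum>i = 1..npts B \<nu>. \<bar>beta B \<nu> i\<bar>"
  show "?a / \<bar>alpha B \<nu> 0\<bar> \<ge> 0" "?b / \<bar>beta B \<nu> 0\<bar> \<ge> 0"
    by (simp_all add: sum_nonneg)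
  show "(?a / \<bar>alpha B \<nu> 0\<bar>)\<^sup>2 + (?b / \<bar>beta B \<nu> 0\<bar>)\<^sup>2 < 1"
    using assms by (simp add: small_coeffs_def power_divide)
  show "?a = ?a / \<bar>alpha B \<nu> 0\<bar> * \<bar>alpha B \<nu> 0\<bar>" "?b = ?b / \<bar>beta B \<nu> 0\<bar> * \<bar>beta B \<nu> 0\<bar>"
    using assms by (auto simp: small_coeffs_def)
qed

lemma sum_abs_weighted_le:
  fixes w f :: "'i \<Rightarrow> real"
  assumes "\<And>i. i \<in> I \<Longrightarrow> \<bar>f i\<bar> \<le> C"
  shows "\<bar>\<Sum>i\<in>I. w i * f i\<bar> \<le> (\<Sum>i\<in>I. \<bar>w i\<bar>) * C"
proof -
  have "\<bar>\<Sum>i\<in>I. w i * f i\<bar> \<le> (\<Sum>i\<in>I. \<bar>w i * f i\<bar>)" by (rule sum_abs)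
  also have "\<dots> \<le> (\<Sum>i\<in>I. \<bar>w i\<bar> * C)"
    using assms by (intro sum_mono) (auto simp: abs_mult intro: mult_left_mono)
  finally show ?thesis by (simp add: sum_distrib_right)
qed

lemma cauchy_schwarz_2: "(p::real) * a + q * b \<le> sqrt (p\<^sup>2 + q\<^sup>2) * sqrt (a\<^sup>2 + b\<^sup>2)"
proof -
  have "(p * a + q * b)\<^sup>2 \<le> (p\<^sup>2 + q\<^sup>2) * (a\<^sup>2 + b\<^sup>2)"
    using zero_le_power2[of "p * b - q * a"] by (simp add: power2_eq_square algebra_simps)
  then show ?thesis
    by (metis real_le_rsqrt real_sqrt_mult)
qed

section \<open>The boundary estimate for a rotating pair\<close>

text \<open>In the application, \<open>x\<close> and \<open>y\<close> are $s\varphi$ and $\varphi'$ at the points $\eta_i$,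
  \<open>X\<close> and \<open>Y\<close> the same at the end point, \<open>\<delta>\<close> is the value of an affine function relative to
  the end point, and \<open>\<epsilon>\<close> its slope divided by $s$.

  The matrix of the two equations in \<open>X\<close> and \<open>Y\<close> has determinant
  $D = a^2 + b^2 + \epsilon a b$, positive by the sign condition. Multiplying by its adjugate
  gives, in complex notation with $z = X + iY$,
  $$D z = (a + ib)\Bigl[\sum \alpha_i (x_i + i\delta_i y_i) +
    \sum \beta_i (y_i - i\delta_i x_i)\Bigr] +
    \epsilon\Bigl[b \sum \alpha_i x_i + i a \sum \beta_i y_i\Bigr].$$
  The two summands are estimated separately. With $\rho = \sqrt E$ and
  $\kappa = \sqrt{P^2 + Q^2}$, the first bracket is at most
  $\rho (P|a| + Q|b|) \le \rho\kappa\sqrt{a^2 + b^2}$ by Cauchy-Schwarz. The entries of the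
  second one are at most $P|ab|\rho$ and $Q|ab|\rho$; since they are orthogonal, its norm is at
  most $\kappa|ab|\rho$, with no loss from a triangle inequality. Hence
  $D\rho = |Dz| \le \kappa D \rho$, while $\kappa < 1$.\<close>

lemma rotating_pair_contradiction:
  fixes \<alpha> \<beta> x y \<delta> :: "'i \<Rightarrow> real" and a b X Y \<epsilon> P Q E :: real
  assumes E: "E > 0" "X\<^sup>2 + Y\<^sup>2 = E" "\<And>i. i \<in> I \<Longrightarrow> (x i)\<^sup>2 + (y i)\<^sup>2 = E"
    and delta: "\<And>i. i \<in> I \<Longrightarrow> \<bar>\<delta> i\<bar> \<le> 1"
    and ab: "a \<noteq> 0 \<or> b \<noteq> 0" and eps: "\<epsilon> * a * b \<ge> 0"
    and PQ: "P \<ge> 0" "Q \<ge> 0" "P\<^sup>2 + Q\<^sup>2 < 1"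
      "(\<Sum>i\<in>I. \<bar>\<alpha> i\<bar>) = P * \<bar>a\<bar>" "(\<Sum>i\<in>I. \<bar>\<beta> i\<bar>) = Q * \<bar>b\<bar>"
    and eq1: "a * X + b * Y = (\<Sum>i\<in>I. \<alpha> i * x i) + (\<Sum>i\<in>I. \<beta> i * y i)"
    and eq2: "a * Y - b * X + \<epsilon> * b * Y =
      (\<Sum>i\<in>I. \<alpha> i * (\<delta> i * y i)) + (\<Sum>i\<in>I. \<beta> i * (\<epsilon> * y i - \<delta> i * x i))"
  shows False
proof -
  define \<kappa> where "\<kappa> = sqrt (P\<^sup>2 + Q\<^sup>2)"
  define \<rho> where "\<rho> = sqrt E"
  define R where "R = sqrt (a\<^sup>2 + b\<^sup>2)"
  define D where "D = R\<^sup>2 + \<epsilon> * a * b"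
  have kappa: "0 \<le> \<kappa>" "\<kappa> < 1" using PQ by (auto simp: \<kappa>_def)
  have rho: "\<rho> > 0" using E by (simp add: \<rho>_def)
  have R2: "R\<^sup>2 = a\<^sup>2 + b\<^sup>2" by (simp add: R_def)
  have "R\<^sup>2 > 0" using ab by (auto simp: R2 sum_power2_gt_zero_iff)
  then have D: "D > 0" unfolding D_def using eps by linarith
  have R0: "R \<ge> 0" by (simp add: R_def)
  define V where "V = (\<Sum>i\<in>I. of_real (\<alpha> i) * Complex (x i) (\<delta> i * y i)) +
    (\<Sum>i\<in>I. of_real (\<beta> i) * Complex (y i) (- (\<delta> i * x i)))"
  define W where "W = Complex (b * (\<Sum>i\<in>I. \<alpha> i * x i)) (a * (\<Sum>i\<in>I. \<beta> i * y i))"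
  let ?xa = "\<Sum>i\<in>I. \<alpha> i * x i" and ?yb = "\<Sum>i\<in>I. \<beta> i * y i"
  let ?ya = "\<Sum>i\<in>I. \<alpha> i * (\<delta> i * y i)" and ?xb = "\<Sum>i\<in>I. \<beta> i * (\<delta> i * x i)"
  have ReV: "Re V = ?xa + ?yb" and ImV: "Im V = ?ya - ?xb"
    by (simp_all add: V_def sum_negf)
  have eq2': "a * Y - b * X + \<epsilon> * b * Y = ?ya + \<epsilon> * ?yb - ?xb"
    unfolding eq2 by (simp add: algebra_simps sum.distrib sum_subtractf sum_distrib_left)
  have id: "of_real D * Complex X Y = Complex a b * V + of_real \<epsilon> * W"
  proof -
    have "D * X = (a + \<epsilon> * b) * (a * X + b * Y) - b * (a * Y - b * X + \<epsilon> * b * Y)"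
      "D * Y = a * (a * Y - b * X + \<epsilon> * b * Y) + b * (a * X + b * Y)"
      unfolding D_def R2 by (simp_all add: power2_eq_square algebra_simps)
    then have "D * X = a * (?xa + ?yb) - b * (?ya - ?xb) + \<epsilon> * (b * ?xa)"
      "D * Y = a * (?ya - ?xb) + b * (?xa + ?yb) + \<epsilon> * (a * ?yb)"
      unfolding eq1 eq2' by (simp_all add: algebra_simps)
    then show ?thesis
      by (simp add: complex_eq_iff ReV ImV W_def)
  qed
  have nx: "\<bar>x i\<bar> \<le> \<rho>" and ny: "\<bar>y i\<bar> \<le> \<rho>" if "i \<in> I" for i
    unfolding \<rho>_def using E(3)[OF that] by (auto intro!: real_le_rsqrt)
  have dsq: "(\<delta> i * t)\<^sup>2 \<le> t\<^sup>2" if "i \<in> I" for i t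
  proof -
    have "(\<delta> i)\<^sup>2 \<le> 1" using delta[OF that] by (simp add: abs_square_le_1)
    then show ?thesis
      using mult_right_mono[of "(\<delta> i)\<^sup>2" 1 "t\<^sup>2"] by (simp add: power_mult_distrib)
  qed
  have "cmod V \<le> (\<Sum>i\<in>I. \<bar>\<alpha> i\<bar> * \<rho>) + (\<Sum>i\<in>I. \<bar>\<beta> i\<bar> * \<rho>)"
    unfolding V_def
  proof (rule norm_triangle_le, rule add_mono; rule sum_norm_le)
    fix i assume i: "i \<in> I"
    have "cmod (Complex (x i) (\<delta> i * y i)) \<le> \<rho>" "cmod (Complex (y i) (- (\<delta> i * x i))) \<le> \<rho>"
      using dsq[OF i, of "y i"] dsq[OF i, of "x i"] E(3)[OF i]
      by (auto simp: cmod_def \<rho>_def)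
    then show "cmod (of_real (\<alpha> i) * Complex (x i) (\<delta> i * y i)) \<le> \<bar>\<alpha> i\<bar> * \<rho>"
      "cmod (of_real (\<beta> i) * Complex (y i) (- (\<delta> i * x i))) \<le> \<bar>\<beta> i\<bar> * \<rho>"
      by (auto simp: norm_mult intro: mult_left_mono)
  qed
  also have "\<dots> = (P * \<bar>a\<bar> + Q * \<bar>b\<bar>) * \<rho>"
    unfolding sum_distrib_right[symmetric] PQ(4,5) by (simp add: distrib_right)
  also have "\<dots> \<le> (\<kappa> * R) * \<rho>"
    using cauchy_schwarz_2[of P "\<bar>a\<bar>" Q "\<bar>b\<bar>"] rho
    by (intro mult_right_mono) (simp_all add: \<kappa>_def R_def)
  finally have V: "cmod V \<le> \<kappa> * R * \<rho>" .
  have "\<bar>?xa\<bar> \<le> P * \<bar>a\<bar> * \<rho>" "\<bar>?yb\<bar> \<le> Q * \<bar>b\<bar> * \<rho>"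
    using sum_abs_weighted_le[of I x \<rho> \<alpha>] sum_abs_weighted_le[of I y \<rho> \<beta>] nx ny PQ(4,5) by auto
  then have "\<bar>b * ?xa\<bar> \<le> P * (\<bar>a * b\<bar> * \<rho>)" "\<bar>a * ?yb\<bar> \<le> Q * (\<bar>a * b\<bar> * \<rho>)"
    using mult_left_mono[of "\<bar>?xa\<bar>" "P * \<bar>a\<bar> * \<rho>" "\<bar>b\<bar>"]
      mult_left_mono[of "\<bar>?yb\<bar>" "Q * \<bar>b\<bar> * \<rho>" "\<bar>a\<bar>"]
    by (simp_all add: abs_mult algebra_simps)
  then have "(b * ?xa)\<^sup>2 \<le> (P * (\<bar>a * b\<bar> * \<rho>))\<^sup>2" "(a * ?yb)\<^sup>2 \<le> (Q * (\<bar>a * b\<bar> * \<rho>))\<^sup>2"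
    by (metis abs_ge_zero power2_abs power_mono)+
  then have "(b * ?xa)\<^sup>2 + (a * ?yb)\<^sup>2 \<le> (P\<^sup>2 + Q\<^sup>2) * (\<bar>a * b\<bar> * \<rho>)\<^sup>2"
    by (simp add: power_mult_distrib algebra_simps)
  then have "cmod W \<le> sqrt ((P\<^sup>2 + Q\<^sup>2) * (\<bar>a * b\<bar> * \<rho>)\<^sup>2)"
    by (simp add: W_def cmod_def)
  also have "\<dots> = \<kappa> * (\<bar>a * b\<bar> * \<rho>)"
    using rho by (simp add: \<kappa>_def real_sqrt_mult abs_mult)
  finally have W: "cmod W \<le> \<kappa> * (\<bar>a * b\<bar> * \<rho>)" .
  have "cmod (Complex X Y) = \<rho>" using E(2) by (simp add: complex_norm \<rho>_def)
  then have "D * \<rho> = cmod (of_real D * Complex X Y)"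
    unfolding norm_mult using D by simp
  also have "\<dots> \<le> cmod (Complex a b * V) + cmod (of_real \<epsilon> * W)"
    unfolding id by (rule norm_triangle_ineq)
  also have "\<dots> = R * cmod V + \<bar>\<epsilon>\<bar> * cmod W"
    unfolding norm_mult by (simp add: complex_norm R_def)
  also have "\<dots> \<le> R * (\<kappa> * R * \<rho>) + \<bar>\<epsilon>\<bar> * (\<kappa> * (\<bar>a * b\<bar> * \<rho>))"
    using V W R0 by (intro add_mono mult_left_mono) auto
  also have "\<dots> = \<kappa> * (R\<^sup>2 + \<bar>\<epsilon> * a * b\<bar>) * \<rho>"
    by (simp add: power2_eq_square abs_mult algebra_simps)
  also have "\<dots> = \<kappa> * (D * \<rho>)"
    using eps by (simp add: D_def)
  also have "\<dots> < D * \<rho>"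
    using kappa D rho by simp
  finally show False by simp
qed

section \<open>Eigenfunctions under small multi-point coefficients\<close>

locale small_bc =
  fixes B :: bc_data
  assumes valid: "valid_bc B"
    and alpha_nonneg: "\<And>\<nu>. alpha B \<nu> 0 \<ge> 0"
    and nontrivial: "\<And>\<nu>. alpha B \<nu> 0 + \<bar>beta B \<nu> 0\<bar> > 0"
    and beta_sign: "\<And>\<nu>. sgn_val \<nu> * beta B \<nu> 0 \<ge> 0"
    and small: "\<And>\<nu>. small_coeffs B \<nu>"
    and alpha_pos: "alpha B Minus 0 + alpha B Plus 0 > 0"
begin

lemma eta_in: "i \<in> {1..npts B \<nu>} \<Longrightarrow> eta B \<nu> i \<in> {-1..1}"
  using valid unfolding valid_bc_def by blast

text \<open>The condition on the signs of \<open>p\<close> and \<open>q\<close> says that \<open>p + q x\<close> has its largest modulus at the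
  end point \<open>\<nu>\<close>. After scaling by that value, \<open>rotating_pair_contradiction\<close> applies to
  $(s\varphi, \varphi')$ with $b = s\beta_0$.\<close>

lemma resonance_violates_bc:
  assumes lam: "\<mu> > 0"
    and phi: "deriv_on_I \<phi> \<phi>1" "deriv_on_I \<phi>1 (\<lambda>x. - \<mu> * \<phi> x)"
    and nz: "(\<phi>1 0)\<^sup>2 + \<mu> * (\<phi> 0)\<^sup>2 > 0"
    and bc: "bc_defect B \<nu> \<phi> \<phi>1 = 0"
    and bc': "bc_defect B \<nu> (\<lambda>x. (p + q * x) * \<phi>1 x)
      (\<lambda>x. q * \<phi>1 x - \<mu> * (p + q * x) * \<phi> x) = 0"
    and pq: "sgn_val \<nu> * (p * q) \<ge> 0" and "p \<noteq> 0 \<or> q \<noteq> 0"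
  shows False
proof -
  define s where "s = sqrt \<mu>"
  have s: "s > 0" "s * s = \<mu>" using lam by (auto simp: s_def)
  define \<sigma> where "\<sigma> = sgn_val \<nu>"
  define L where "L = p + q * \<sigma>"
  define E where "E = (\<phi>1 0)\<^sup>2 + \<mu> * (\<phi> 0)\<^sup>2"
  have sig: "\<sigma> = 1 \<or> \<sigma> = -1" by (cases \<nu>) (auto simp: \<sigma>_def)
  \<comment> \<open>No cancellation occurs in the value \<open>L\<close> at the chosen end point.\<close>
  have L2: "L\<^sup>2 = p\<^sup>2 + q\<^sup>2 + 2 * (\<sigma> * (p * q))"
    using sig by (auto simp: L_def power2_eq_square algebra_simps)
  moreover have "p\<^sup>2 + q\<^sup>2 > 0" using assms(8) by (simp add: sum_power2_gt_zero_iff)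
  ultimately have L: "L \<noteq> 0" using pq by (auto simp: \<sigma>_def)
  define ratio where "ratio x = (p + q * x) / L" for x
  have dL: "\<bar>ratio x\<bar> \<le> 1" if x: "x \<in> {-1..1}" for x
  proof -
    have "q * x * (q * x) \<le> q * q"
      using x mult_left_mono[of "x * x" 1 "q * q"] abs_square_le_1[of x]
      by (auto simp: power2_eq_square algebra_simps)
    moreover have "(p * q) * x \<le> \<sigma> * (p * q)"
    proof -
      have "(p * q) * x \<le> \<bar>p * q\<bar> * \<bar>x\<bar>"
        using abs_ge_self[of "p * q * x"] by (simp only: abs_mult)
      also have "\<dots> \<le> \<bar>p * q\<bar> * 1"
        using x by (intro mult_left_mono) auto
      also have "\<dots> = \<sigma> * (p * q)" using pq sig by (auto simp: \<sigma>_def)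
      finally show ?thesis .
    qed
    ultimately have "(p + q * x)\<^sup>2 \<le> L\<^sup>2"
      unfolding L2 by (simp add: power2_eq_square algebra_simps)
    then have "\<bar>p + q * x\<bar> \<le> \<bar>L\<bar>" by (simp add: abs_le_square_iff)
    then show ?thesis using L by (simp add: ratio_def)
  qed
  have en: "(s * \<phi> x)\<^sup>2 + (\<phi>1 x)\<^sup>2 = E" if "x \<in> {-1..1}" for x
    using oscillator_energy_constant[OF phi that, of 0] s
    by (simp add: E_def power_mult_distrib power2_eq_square[of s] algebra_simps)
  obtain P Q where PQ: "P \<ge> 0" "Q \<ge> 0" "P\<^sup>2 + Q\<^sup>2 < 1"
    "(\<Sum>i = 1..npts B \<nu>. \<bar>alpha B \<nu> i\<bar>) = P * \<bar>alpha B \<nu> 0\<bar>"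
    "(\<Sum>i = 1..npts B \<nu>. \<bar>beta B \<nu> i\<bar>) = Q * \<bar>beta B \<nu> 0\<bar>"
    using small_coeffsE[OF small] by metis
  show False
  proof (rule rotating_pair_contradiction[where I = "{1..npts B \<nu>}" and E = E
        and X = "s * \<phi> \<sigma>" and Y = "\<phi>1 \<sigma>"
        and x = "\<lambda>i. s * \<phi> (eta B \<nu> i)" and y = "\<lambda>i. \<phi>1 (eta B \<nu> i)"
        and \<delta> = "\<lambda>i. ratio (eta B \<nu> i)" and \<epsilon> = "q / (s * L)"
        and \<alpha> = "alpha B \<nu>" and \<beta> = "\<lambda>i. s * beta B \<nu> i"
        and a = "alpha B \<nu> 0" and b = "s * beta B \<nu> 0" and P = P and Q = Q])
    show "E > 0" using nz by (simp add: E_def)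
    show "(s * \<phi> \<sigma>)\<^sup>2 + (\<phi>1 \<sigma>)\<^sup>2 = E" using en[OF sgn_val_in] by (simp add: \<sigma>_def)
    show "(s * \<phi> (eta B \<nu> i))\<^sup>2 + (\<phi>1 (eta B \<nu> i))\<^sup>2 = E" if "i \<in> {1..npts B \<nu>}" for i
      using en[OF eta_in[OF that]] .
    show "\<bar>ratio (eta B \<nu> i)\<bar> \<le> 1" if "i \<in> {1..npts B \<nu>}" for i
      using dL[OF eta_in[OF that]] .
    show "alpha B \<nu> 0 \<noteq> 0 \<or> s * beta B \<nu> 0 \<noteq> 0"
      using nontrivial[of \<nu>] s by auto
    show "q / (s * L) * alpha B \<nu> 0 * (s * beta B \<nu> 0) \<ge> 0"
    proof -
      \<comment> \<open>The slope of the affine factor relative to \<open>L\<close> points outwards, and so does \<open>beta\<close> at 0.\<close>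
      have "q * L * \<sigma> = \<sigma> * (p * q) + q\<^sup>2"
        using sig by (auto simp: L_def power2_eq_square algebra_simps)
      also have "\<dots> \<ge> 0" using pq by (simp add: \<sigma>_def)
      finally have qL: "q * L * \<sigma> \<ge> 0" .
      have "\<sigma> * beta B \<nu> 0 \<ge> 0" using beta_sign by (simp add: \<sigma>_def)
      with qL have "(q * L * \<sigma>) * (alpha B \<nu> 0 * (\<sigma> * beta B \<nu> 0)) / L\<^sup>2 \<ge> 0"
        by (intro divide_nonneg_nonneg mult_nonneg_nonneg[of "q * L * \<sigma>"]
            mult_nonneg_nonneg[OF alpha_nonneg]) simp_all
      also have "(q * L * \<sigma>) * (alpha B \<nu> 0 * (\<sigma> * beta B \<nu> 0)) / L\<^sup>2 =
          q / (s * L) * alpha B \<nu> 0 * (s * beta B \<nu> 0)"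
        using sig L s by (auto simp: field_simps power2_eq_square)
      finally show ?thesis .
    qed
    show "P \<ge> 0" "Q \<ge> 0" "P\<^sup>2 + Q\<^sup>2 < 1" by fact+
    show "(\<Sum>i = 1..npts B \<nu>. \<bar>alpha B \<nu> i\<bar>) = P * \<bar>alpha B \<nu> 0\<bar>" by fact
    show "(\<Sum>i = 1..npts B \<nu>. \<bar>s * beta B \<nu> i\<bar>) = Q * \<bar>s * beta B \<nu> 0\<bar>"
      using s PQ(5) by (simp add: abs_mult sum_distrib_left[symmetric])
    have "s * bc_defect B \<nu> \<phi> \<phi>1 = 0" using bc by simp
    then show "alpha B \<nu> 0 * (s * \<phi> \<sigma>) + s * beta B \<nu> 0 * \<phi>1 \<sigma> =
      (\<Sum>i = 1..npts B \<nu>. alpha B \<nu> i * (s * \<phi> (eta B \<nu> i))) +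
      (\<Sum>i = 1..npts B \<nu>. s * beta B \<nu> i * \<phi>1 (eta B \<nu> i))"
      by (simp add: bc_defect_def \<sigma>_def algebra_simps sum_distrib_left)
    have conv: "t * (q * \<phi>1 x - \<mu> * (p + q * x) * \<phi> x) / L =
        s * t * (q / (s * L) * \<phi>1 x - ratio x * (s * \<phi> x))" for t x
      using L s(1) by (simp add: s(2)[symmetric] ratio_def field_simps)
    have conv': "t * ((p + q * x) * \<phi>1 x) / L = t * (ratio x * \<phi>1 x)" for t x
      by (simp add: ratio_def)
    have "bc_defect B \<nu> (\<lambda>x. (p + q * x) * \<phi>1 x)
      (\<lambda>x. q * \<phi>1 x - \<mu> * (p + q * x) * \<phi> x) / L = 0" using bc' by simp
    then have "alpha B \<nu> 0 * (ratio \<sigma> * \<phi>1 \<sigma>) +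
        s * beta B \<nu> 0 * (q / (s * L) * \<phi>1 \<sigma> - ratio \<sigma> * (s * \<phi> \<sigma>)) =
      (\<Sum>i = 1..npts B \<nu>. alpha B \<nu> i * (ratio (eta B \<nu> i) * \<phi>1 (eta B \<nu> i))) +
      (\<Sum>i = 1..npts B \<nu>. s * beta B \<nu> i *
        (q / (s * L) * \<phi>1 (eta B \<nu> i) - ratio (eta B \<nu> i) * (s * \<phi> (eta B \<nu> i))))"
      unfolding bc_defect_def diff_divide_distrib add_divide_distrib sum_divide_distrib conv conv'
      by (simp add: \<sigma>_def)
    moreover have regroup: "a * (1 * Y) + b * (e * Y - 1 * X) = a * Y - b * X + e * b * Y"
      for a b e X Y :: real
      by (simp add: algebra_simps)
    moreover have "ratio \<sigma> = 1" using L by (simp add: ratio_def L_def)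
    ultimately show "alpha B \<nu> 0 * \<phi>1 \<sigma> - s * beta B \<nu> 0 * (s * \<phi> \<sigma>) +
        q / (s * L) * (s * beta B \<nu> 0) * \<phi>1 \<sigma> =
      (\<Sum>i = 1..npts B \<nu>. alpha B \<nu> i * (ratio (eta B \<nu> i) * \<phi>1 (eta B \<nu> i))) +
      (\<Sum>i = 1..npts B \<nu>. s * beta B \<nu> i *
        (q / (s * L) * \<phi>1 (eta B \<nu> i) - ratio (eta B \<nu> i) * (s * \<phi> (eta B \<nu> i))))"
      by (simp only: regroup)
  qed
qed

text \<open>By the sign conditions the two terms at the end point do not cancel, and each of them dominates
  the corresponding sum over the points \<open>eta\<close>, strictly unless it is zero.\<close>

lemma bc_at_maximum:
  assumes bc: "bc_defect B \<nu> u u1 = 0"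
    and max: "\<And>x. x \<in> {-1..1} \<Longrightarrow> \<bar>u x\<bar> \<le> \<bar>u (sgn_val \<nu>)\<bar>"
      "\<And>x. x \<in> {-1..1} \<Longrightarrow> \<bar>u1 x\<bar> \<le> \<bar>u1 (sgn_val \<nu>)\<bar>"
    and outward: "sgn_val \<nu> * (u (sgn_val \<nu>) * u1 (sgn_val \<nu>)) \<ge> 0"
  shows "alpha B \<nu> 0 * u (sgn_val \<nu>) = 0" "beta B \<nu> 0 * u1 (sgn_val \<nu>) = 0"
proof -
  define U where "U = alpha B \<nu> 0 * u (sgn_val \<nu>)"
  define V where "V = beta B \<nu> 0 * u1 (sgn_val \<nu>)"
  obtain P Q where PQ: "P \<ge> 0" "Q \<ge> 0" "P\<^sup>2 + Q\<^sup>2 < 1"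
    "(\<Sum>i = 1..npts B \<nu>. \<bar>alpha B \<nu> i\<bar>) = P * \<bar>alpha B \<nu> 0\<bar>"
    "(\<Sum>i = 1..npts B \<nu>. \<bar>beta B \<nu> i\<bar>) = Q * \<bar>beta B \<nu> 0\<bar>"
    using small_coeffsE[OF small] by metis
  have "P\<^sup>2 < 1" "Q\<^sup>2 < 1"
    using PQ(3) zero_le_power2[of P] zero_le_power2[of Q] by linarith+
  then have PQ1: "P < 1" "Q < 1" using PQ(1,2) by (auto simp: abs_square_less_1)
  have "U * V = alpha B \<nu> 0 * (sgn_val \<nu> * beta B \<nu> 0) *
      (sgn_val \<nu> * (u (sgn_val \<nu>) * u1 (sgn_val \<nu>)))"
    by (cases \<nu>) (simp_all add: U_def V_def)
  also have "\<dots> \<ge> 0"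
    using alpha_nonneg[of \<nu>] beta_sign[of \<nu>] outward by simp
  finally have "\<bar>U\<bar> + \<bar>V\<bar> = \<bar>U + V\<bar>"
    by (auto simp: zero_le_mult_iff)
  also have "\<dots> = \<bar>(\<Sum>i = 1..npts B \<nu>. alpha B \<nu> i * u (eta B \<nu> i)) +
      (\<Sum>i = 1..npts B \<nu>. beta B \<nu> i * u1 (eta B \<nu> i))\<bar>"
    using bc by (simp add: bc_defect_def U_def V_def)
  also have "\<dots> \<le> P * \<bar>alpha B \<nu> 0\<bar> * \<bar>u (sgn_val \<nu>)\<bar> + Q * \<bar>beta B \<nu> 0\<bar> * \<bar>u1 (sgn_val \<nu>)\<bar>"
    unfolding PQ(4,5)[symmetric]
    by (intro order_trans[OF abs_triangle_ineq] add_mono sum_abs_weighted_le max eta_in)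
  also have "\<dots> = P * \<bar>U\<bar> + Q * \<bar>V\<bar>" by (simp add: U_def V_def abs_mult)
  finally have "(1 - P) * \<bar>U\<bar> + (1 - Q) * \<bar>V\<bar> \<le> 0" by (simp add: algebra_simps)
  moreover have "(1 - P) * \<bar>U\<bar> \<ge> 0" "(1 - Q) * \<bar>V\<bar> \<ge> 0" using PQ1 by auto
  ultimately have "(1 - P) * \<bar>U\<bar> = 0" "(1 - Q) * \<bar>V\<bar> = 0" by linarith+
  then show "U = 0" "V = 0" using PQ1 by auto
qed

text \<open>The derivative $2uu'$ of $u^2$ is non-decreasing, so $u^2$ is largest at one of the end points
  and does not decrease in the outward direction there. As $u'^2 = \mathrm{const} - \mu u^2$
  with $\mu \le 0$, the same end point maximises $|u'|$, and \<open>bc_at_maximum\<close> applies.\<close>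

lemma nonpositive_no_eigenfunction:
  assumes lam: "\<mu> \<le> 0"
    and u: "deriv_on_I u u1" "deriv_on_I u1 (\<lambda>x. - \<mu> * u x)"
    and bc: "\<And>\<nu>. bc_defect B \<nu> u u1 = 0"
    and x: "x \<in> {-1..1}"
  shows "u x = 0"
proof -
  define g where "g x = (u x)\<^sup>2" for x
  define h where "h x = 2 * (u x * u1 x)" for x
  have g: "deriv_on_I g h"
    using u(1) unfolding deriv_on_I_def g_def h_def
    by (auto intro!: derivative_eq_intros)
  have "deriv_on_I h (\<lambda>x. 2 * ((u1 x)\<^sup>2 - \<mu> * (u x)\<^sup>2))"
    using u unfolding deriv_on_I_def h_def
    by (auto intro!: derivative_eq_intros simp: power2_eq_square algebra_simps)
  then have mono: "h x \<le> h y" if "-1 \<le> x" "x \<le> y" "y \<le> 1" for x y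
  proof (rule deriv_on_I_nonneg_mono[OF _ _ that])
    fix x
    have "\<mu> * (u x)\<^sup>2 \<le> 0" using lam by (simp add: mult_nonpos_nonneg)
    then have "\<mu> * (u x)\<^sup>2 \<le> (u1 x)\<^sup>2" by (rule order_trans) simp
    then show "2 * ((u1 x)\<^sup>2 - \<mu> * (u x)\<^sup>2) \<ge> 0" by simp
  qed
  have ends: "g y \<le> max (g (-1)) (g 1)" if y: "y \<in> {-1..1}" for y
  proof (rule ccontr)
    assume "\<not> ?thesis"
    then have gt: "g y > g (-1)" "g y > g 1" by auto
    then have "y \<noteq> -1" "y \<noteq> 1" by auto
    then have y': "-1 < y" "y < 1" using y by auto
    obtain z1 where z1: "-1 < z1" "z1 < y" "g y - g (-1) = (y - (-1)) * h z1"
      using deriv_on_I_mvt[OF g, of "-1" y] y' by auto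
    obtain z2 where z2: "y < z2" "z2 < 1" "g 1 - g y = (1 - y) * h z2"
      using deriv_on_I_mvt[OF g, of y 1] y' by auto
    have "(y - (-1)) * h z1 > 0" "(1 - y) * h z2 < 0" using gt z1(3) z2(3) by linarith+
    then have "h z1 > 0" "h z2 < 0" using y' by (auto simp: zero_less_mult_iff mult_less_0_iff)
    moreover have "h z1 \<le> h z2" using mono z1 z2 by auto
    ultimately show False by simp
  qed
  obtain z where z: "-1 < z" "z < 1" "g 1 - g (-1) = 2 * h z"
    using deriv_on_I_mvt[OF g, of "-1" 1] by auto
  have hz: "h (-1) \<le> h z" "h z \<le> h 1" using mono z by auto
  obtain \<nu> where nu: "\<And>y. y \<in> {-1..1} \<Longrightarrow> g y \<le> g (sgn_val \<nu>)" "sgn_val \<nu> * h (sgn_val \<nu>) \<ge> 0"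
  proof (cases "g 1 \<ge> g (-1)")
    case True
    then have "h 1 \<ge> 0" using hz z(3) by linarith
    then show ?thesis using that[of Plus] ends True by (simp add: max_def)
  next
    case False
    then have "h (-1) \<le> 0" using hz z(3) by linarith
    then show ?thesis using that[of Minus] ends False by (simp add: max_def)
  qed
  let ?e = "sgn_val \<nu>"
  have mu: "\<bar>u y\<bar> \<le> \<bar>u ?e\<bar>" if "y \<in> {-1..1}" for y
    using nu(1)[OF that] by (simp add: g_def abs_le_square_iff)
  have mu1: "\<bar>u1 y\<bar> \<le> \<bar>u1 ?e\<bar>" if y: "y \<in> {-1..1}" for y
  proof -
    have "- \<mu> * g y \<le> - \<mu> * g ?e"
      using nu(1)[OF y] lam by (intro mult_left_mono) auto
    then have "(u1 y)\<^sup>2 \<le> (u1 ?e)\<^sup>2"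
      using oscillator_energy_constant[OF u y sgn_val_in[of \<nu>]] by (simp add: g_def)
    then show ?thesis by (simp add: abs_le_square_iff)
  qed
  have vanish: "alpha B \<nu> 0 * u ?e = 0" "beta B \<nu> 0 * u1 ?e = 0"
    using bc_at_maximum[OF bc mu mu1] nu(2) by (auto simp: h_def)
  show ?thesis
  proof (cases "alpha B \<nu> 0 = 0")
    case False
    then have "u ?e = 0" using vanish(1) by simp
    then show ?thesis using mu[OF x] by simp
  next
    case True
    then have "u1 ?e = 0" using nontrivial[of \<nu>] vanish(2) by auto
    \<comment> \<open>Only constants remain; they are excluded at an end point with positive \<open>alpha\<close>.\<close>
    then have u1: "u1 y = 0" if "y \<in> {-1..1}" for y using mu1[OF that] by simp
    then have "\<exists>c. \<forall>y\<in>{-1..1}. u y = c"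
      using u(1) unfolding deriv_on_I_def
      by (intro has_field_derivative_zero_constant) auto
    then obtain c where c: "\<And>y. y \<in> {-1..1} \<Longrightarrow> u y = c" by blast
    obtain \<tau> where mu0: "alpha B \<tau> 0 \<noteq> 0"
      using alpha_pos by (metis add_0 less_irrefl)
    have "alpha B \<tau> 0 * u (sgn_val \<tau>) = 0"
      using bc_at_maximum(1)[OF bc[of \<tau>]] c u1 sgn_val_in[of \<tau>] by auto
    then show ?thesis using mu0 c[OF x] c[OF sgn_val_in[of \<tau>]] by simp
  qed
qed

section \<open>The Laplacian as a bijection from \<open>X\<close> onto \<open>Y\<close>\<close>

lemma X_bcD:
  assumes "u \<in> X_bc B"
  shows "u \<in> C2" "bc_defect B \<nu> (on_real u) (D1 u) = 0"
  using assms by (auto simp: X_bc_def satisfies_bc_iff)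

lemma X_bc_lincomb:
  assumes u: "u \<in> X_bc B" and v: "v \<in> X_bc B"
  shows "a *\<^sub>R u + b *\<^sub>R v \<in> X_bc B"
proof -
  note uv = C2_lincomb[OF X_bcD(1)[OF u] X_bcD(1)[OF v], where a = a and b = b]
  have "bc_defect B \<nu> (on_real (a *\<^sub>R u + b *\<^sub>R v)) (D1 (a *\<^sub>R u + b *\<^sub>R v)) = 0" for \<nu>
  proof -
    have "bc_defect B \<nu> (on_real (a *\<^sub>R u + b *\<^sub>R v)) (D1 (a *\<^sub>R u + b *\<^sub>R v)) =
        bc_defect B \<nu> (\<lambda>x. a * on_real u x + b * on_real v x) (\<lambda>x. a * D1 u x + b * D1 v x)"
      by (rule bc_defect_cong[OF valid]) (simp_all add: on_real_lincomb uv(2))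
    then show ?thesis by (simp add: bc_defect_lincomb X_bcD[OF u] X_bcD[OF v])
  qed
  then show ?thesis using uv(1) by (simp add: X_bc_def satisfies_bc_iff)
qed

lemma Laplacian_lincomb:
  assumes "u \<in> X_bc B" "v \<in> X_bc B"
  shows "Laplacian (a *\<^sub>R u + b *\<^sub>R v) = a *\<^sub>R Laplacian u + b *\<^sub>R Laplacian v"
proof -
  note uv = C2_lincomb[OF X_bcD(1)[OF assms(1)] X_bcD(1)[OF assms(2)], where a = a and b = b]
  have "D2 u x = on_real (Laplacian u) x" "D2 v x = on_real (Laplacian v) x" if "x \<in> {-1..1}" for x
    using Laplacian_eq_iff[OF X_bcD(1)[OF assms(1)]] Laplacian_eq_iff[OF X_bcD(1)[OF assms(2)]] that
    by blast+
  then show ?thesis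
    unfolding Laplacian_eq_iff[OF uv(1)] on_real_lincomb using uv(3) by auto
qed

lemma eigen_equation:
  assumes "u \<in> X_bc B" "Laplacian u = (- \<mu>) *\<^sub>R u + c *\<^sub>R v"
  shows "deriv_on_I (on_real u) (D1 u)"
    "deriv_on_I (D1 u) (\<lambda>x. - \<mu> * on_real u x + c * on_real v x)"
proof -
  note C = X_bcD(1)[OF assms(1)]
  show "deriv_on_I (on_real u) (D1 u)" by (rule C2_derivs(1)[OF C])
  show "deriv_on_I (D1 u) (\<lambda>x. - \<mu> * on_real u x + c * on_real v x)"
    using assms(2) unfolding Laplacian_eq_iff[OF C] on_real_lincomb
    by (intro deriv_on_I_cong[OF C2_derivs(2)[OF C]]) auto
qed

lemma eigenvalue_positive:
  assumes "\<phi> \<in> X_bc B" "\<phi> \<noteq> 0" "Laplacian \<phi> = (- \<mu>) *\<^sub>R \<phi>"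
  shows "\<mu> > 0"
proof (rule ccontr)
  assume "\<not> \<mu> > 0"
  moreover have "deriv_on_I (on_real \<phi>) (D1 \<phi>)" "deriv_on_I (D1 \<phi>) (\<lambda>x. - \<mu> * on_real \<phi> x)"
    using eigen_equation[OF assms(1), of \<mu> 0 0] assms(3) by simp_all
  ultimately have "on_real \<phi> x = 0" if "x \<in> {-1..1}" for x
    using nonpositive_no_eigenfunction[OF _ _ _ X_bcD(2)[OF assms(1)] that, of \<mu>] by auto
  then have "\<phi> = 0" by (intro on_real_eqI) (simp add: on_real_def)
  then show False using assms(2) by simp
qed

lemma Laplacian_inj: "inj_on Laplacian (X_bc B)"
proof (rule inj_onI, rule ccontr)
  fix u v assume uv: "u \<in> X_bc B" "v \<in> X_bc B" "Laplacian u = Laplacian v" "u \<noteq> v"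
  have "1 *\<^sub>R u + (-1) *\<^sub>R v \<in> X_bc B" "Laplacian (1 *\<^sub>R u + (-1) *\<^sub>R v) = 0"
    using X_bc_lincomb[OF uv(1,2), of 1 "-1"] Laplacian_lincomb[OF uv(1,2), of 1 "-1"] uv(3) by simp_all
  then show False
    using eigenvalue_positive[of "u - v" 0] uv(4) by simp
qed

text \<open>Integrating \<open>v\<close> twice leaves an affine function to be chosen so that both boundary conditions
  hold. This is a linear system of two equations in two unknowns whose homogeneous version has
  only the trivial solution, by \<open>nonpositive_no_eigenfunction\<close> for the value 0.\<close>

lemma Laplacian_surj:
  obtains u where "u \<in> X_bc B" "Laplacian u = v"
proof -
  obtain F1 where F1: "deriv_on_I F1 (on_real v)"
    using antiderivative_on_I[OF continuous_on_real] .
  obtain F where F: "deriv_on_I F F1"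
    using antiderivative_on_I[OF deriv_on_I_continuous[OF F1]] .
  define d where "d \<nu> = bc_defect B \<nu> F F1" for \<nu>
  define m where "m \<nu> c = bc_defect B \<nu> (\<lambda>x. fst c + snd c * x) (\<lambda>x. snd c)" for \<nu> c
  have m: "m \<nu> c = fst c * bc_defect B \<nu> (\<lambda>x. 1) (\<lambda>x. 0) + snd c * bc_defect B \<nu> (\<lambda>x. x) (\<lambda>x. 1)"
    for \<nu> c
    using bc_defect_lincomb[of B \<nu> "fst c" "\<lambda>x. 1" "snd c" "\<lambda>x. x" "\<lambda>x. 0" "\<lambda>x. 1"]
    by (simp add: m_def)
  define M where "M c = (m Minus c, m Plus c)" for c
  have lin: "linear M"
    by (rule linearI) (simp_all add: M_def m algebra_simps)
  have "inj M"
    unfolding linear_injective_0[OF lin]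
  proof (intro allI impI)
    fix c assume "M c = 0"
    then have bc: "bc_defect B \<nu> (\<lambda>x. fst c + snd c * x) (\<lambda>x. snd c) = 0" for \<nu>
      by (cases \<nu>) (auto simp: M_def m_def zero_prod_def)
    have "deriv_on_I (\<lambda>x. fst c + snd c * x) (\<lambda>x. snd c)"
      "deriv_on_I (\<lambda>x. snd c) (\<lambda>x. - 0 * (fst c + snd c * x))"
      unfolding deriv_on_I_def by (auto intro!: derivative_eq_intros)
    from nonpositive_no_eigenfunction[OF order_refl this bc, of 0]
      nonpositive_no_eigenfunction[OF order_refl this bc, of 1]
    show "c = 0" by (simp add: prod_eq_iff)
  qed
  then have "surj M"
    using lin linear_injective_imp_surjective by blast
  then obtain c where c: "M c = (- d Minus, - d Plus)" by (metis surjD)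
  define f where "f x = 1 * F x + 1 * (fst c + snd c * x)" for x
  define f1 where "f1 x = 1 * F1 x + 1 * snd c" for x
  have f: "deriv_on_I f f1" "deriv_on_I f1 (on_real v)"
    using F F1 unfolding deriv_on_I_def f_def f1_def by (auto intro!: derivative_eq_intros)
  have bc: "bc_defect B \<nu> f f1 = 0" for \<nu>
    unfolding f_def f1_def bc_defect_lincomb
    using c by (cases \<nu>) (auto simp: M_def m_def d_def)
  define u :: C0 where "u = Bcontfun (\<lambda>t. f (Rep_I11 t))"
  have u: "on_real u x = f x" if "x \<in> {-1..1}" for x
    unfolding u_def by (rule on_real_Bcontfun[OF deriv_on_I_continuous[OF f(1)] that])
  have "deriv_on_I (on_real u) f1" by (rule deriv_on_I_cong[OF f(1) u refl])
  note U = C2_intro[OF this f(2) continuous_on_real]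
  have "bc_defect B \<nu> (on_real u) (D1 u) = 0" for \<nu>
    using bc_defect_cong[OF valid u U(2)] bc by simp
  then have "u \<in> X_bc B" using U(1) by (simp add: X_bc_def satisfies_bc_iff)
  moreover have "Laplacian u = v" using U by (simp add: Laplacian_eq_iff)
  ultimately show ?thesis by (rule that)
qed

lemma Laplacian_inv:
  shows "Laplacian_inv B v \<in> X_bc B" "Laplacian (Laplacian_inv B v) = v"
proof -
  have "v \<in> Laplacian ` X_bc B" using Laplacian_surj[of v] by blast
  then show "Laplacian_inv B v \<in> X_bc B" "Laplacian (Laplacian_inv B v) = v"
    unfolding Laplacian_inv_def by (rule inv_into_into, rule f_inv_into_f)
qed

section \<open>Simplicity of the eigenvalues\<close>

text \<open>The term $\ell\varphi'$ in the general solution satisfies both boundary conditions, because the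
  solution and $\varphi$ do. One of the two end points maximises $|\ell|$, so
  \<open>resonance_violates_bc\<close> leaves only $\ell = 0$.\<close>

lemma resonance_in_span:
  assumes phi: "\<phi> \<in> X_bc B" "\<phi> \<noteq> 0" "Laplacian \<phi> = (- \<mu>) *\<^sub>R \<phi>"
    and u: "u \<in> X_bc B" "Laplacian u = (- \<mu>) *\<^sub>R u + c *\<^sub>R \<phi>"
  obtains a where "u = a *\<^sub>R \<phi>"
proof -
  have lam: "\<mu> > 0" by (rule eigenvalue_positive[OF phi])
  have d: "deriv_on_I (on_real \<phi>) (D1 \<phi>)" "deriv_on_I (D1 \<phi>) (\<lambda>x. - \<mu> * on_real \<phi> x)"
    using eigen_equation[OF phi(1), of \<mu> 0 0] phi(3) by simp_all
  have "\<not> (on_real \<phi> 0 = 0 \<and> D1 \<phi> 0 = 0)"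
  proof
    assume "on_real \<phi> 0 = 0 \<and> D1 \<phi> 0 = 0"
    then have "\<phi> = 0"
      using oscillator_zero(1)[OF lam d] by (intro on_real_eqI) (simp add: on_real_def)
    then show False using phi(2) by simp
  qed
  then have nz: "(D1 \<phi> 0)\<^sup>2 + \<mu> * (on_real \<phi> 0)\<^sup>2 > 0"
    using lam by (metis add_nonneg_pos add_pos_nonneg mult_nonneg_nonneg mult_pos_pos
        less_imp_le zero_le_power2 zero_less_power2)
  obtain a p q where apq:
    "\<And>x. x \<in> {-1..1} \<Longrightarrow> on_real u x = a * on_real \<phi> x + (p + q * x) * D1 \<phi> x"
    "\<And>x. x \<in> {-1..1} \<Longrightarrow> D1 u x = a * D1 \<phi> x + (q * D1 \<phi> x - \<mu> * (p + q * x) * on_real \<phi> x)"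
    using resonant_oscillator[OF lam d _ eigen_equation[OF u]] nz by (metis less_irrefl)
  have bc: "bc_defect B \<nu> (\<lambda>x. (p + q * x) * D1 \<phi> x)
      (\<lambda>x. q * D1 \<phi> x - \<mu> * (p + q * x) * on_real \<phi> x) = 0" for \<nu>
  proof -
    have "bc_defect B \<nu> (on_real u) (D1 u) =
      bc_defect B \<nu> (\<lambda>x. a * on_real \<phi> x + 1 * ((p + q * x) * D1 \<phi> x))
        (\<lambda>x. a * D1 \<phi> x + 1 * (q * D1 \<phi> x - \<mu> * (p + q * x) * on_real \<phi> x))"
      by (rule bc_defect_cong[OF valid]) (simp_all add: apq)
    then show ?thesis
      unfolding bc_defect_lincomb by (simp add: X_bcD[OF phi(1)] X_bcD[OF u(1)])
  qed
  obtain \<nu> where "sgn_val \<nu> * (p * q) \<ge> 0"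
    by (metis linear mult_minus1 mult_1 neg_0_le_iff_le sgn_val.simps)
  with resonance_violates_bc[OF lam d nz X_bcD(2)[OF phi(1)] bc] have "p = 0" "q = 0"
    by blast+
  then have "on_real u x = on_real (a *\<^sub>R \<phi>) x" if "x \<in> {-1..1}" for x
    using apq(1)[OF that] by (simp add: on_real_def)
  then show ?thesis by (intro that[of a] on_real_eqI)
qed

text \<open>The identity $v = c\varphi - \mu T v$ for the factor that is applied first shows that \<open>v\<close> inherits
  regularity and boundary conditions, and turns the abstract equation into the differential
  equation of \<open>resonance_in_span\<close>.\<close>

lemma null_space_powers:
  assumes phi: "\<phi> \<in> X_bc B" "\<phi> \<noteq> 0" "Laplacian \<phi> = (- \<mu>) *\<^sub>R \<phi>"
  shows "null_space ((\<lambda>v. v + \<mu> *\<^sub>R Laplacian_inv B v) ^^ j) \<subseteq> span {\<phi>}"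
proof (induction j)
  case 0
  then show ?case by (simp add: null_space_def span_zero)
next
  case (Suc j)
  show ?case
  proof
    fix v assume "v \<in> null_space ((\<lambda>v. v + \<mu> *\<^sub>R Laplacian_inv B v) ^^ Suc j)"
    then have "v + \<mu> *\<^sub>R Laplacian_inv B v \<in> span {\<phi>}"
      using Suc.IH by (auto simp: null_space_def funpow_Suc_right simp del: funpow.simps)
    then obtain c where "v + \<mu> *\<^sub>R Laplacian_inv B v = c *\<^sub>R \<phi>"
      by (auto simp: span_singleton)
    then have v: "v = c *\<^sub>R \<phi> + (- \<mu>) *\<^sub>R Laplacian_inv B v"
      by (simp add: algebra_simps)
    have "v \<in> X_bc B"
      by (subst v) (rule X_bc_lincomb[OF phi(1) Laplacian_inv(1)])
    moreover have "Laplacian v = (- \<mu>) *\<^sub>R v + (- \<mu> * c) *\<^sub>R \<phi>"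
      by (subst v, subst Laplacian_lincomb[OF phi(1) Laplacian_inv(1)])
        (simp add: Laplacian_inv(2) phi(3))
    ultimately obtain a where "v = a *\<^sub>R \<phi>"
      using resonance_in_span[OF phi] by metis
    then show "v \<in> span {\<phi>}" by (auto simp: span_singleton)
  qed
qed

lemma eigenfunction_in_null_space:
  assumes phi: "\<phi> \<in> X_bc B" "\<phi> \<noteq> 0" "Laplacian \<phi> = (- \<mu>) *\<^sub>R \<phi>"
  shows "\<phi> + \<mu> *\<^sub>R Laplacian_inv B \<phi> = 0"
proof -
  have lam: "\<mu> > 0" by (rule eigenvalue_positive[OF phi])
  have "(- 1 / \<mu>) *\<^sub>R \<phi> + 0 *\<^sub>R \<phi> \<in> X_bc B"
    "Laplacian ((- 1 / \<mu>) *\<^sub>R \<phi> + 0 *\<^sub>R \<phi>) = \<phi>"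
    using X_bc_lincomb[OF phi(1) phi(1), of "- 1 / \<mu>" 0] Laplacian_lincomb[OF phi(1) phi(1), of "- 1 / \<mu>" 0]
      phi(3) lam by simp_all
  then have "Laplacian_inv B \<phi> = (- 1 / \<mu>) *\<^sub>R \<phi>"
    using Laplacian_inv[of \<phi>] inj_onD[OF Laplacian_inj] by (metis add.right_neutral scaleR_zero_left)
  then show ?thesis using lam by simp
qed

end

theorem lemma4p16:
  fixes B :: bc_data and lam :: "nat \<Rightarrow> real" and k :: nat
  assumes "valid_bc B"
    and "\<And>\<nu>. alpha B \<nu> 0 \<ge> 0"
    and "\<And>\<nu>. alpha B \<nu> 0 + \<bar>beta B \<nu> 0\<bar> > 0"
    and "\<And>\<nu>. sgn_val \<nu> * beta B \<nu> 0 \<ge> 0"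
    and "\<And>\<nu>. small_coeffs B \<nu>"
    and "alpha B Minus 0 + alpha B Plus 0 > 0"
    and "strict_mono lam" and "range lam = eigenvalues B"
  shows "dim (\<Union>j\<in>{1..}. null_space ((\<lambda>v. v + lam k *\<^sub>R Laplacian_inv B v) ^^ j)) = 1"
proof -
  interpret small_bc B by (unfold_locales) (fact assms)+
  have "lam k \<in> eigenvalues B" using assms(8) by blast
  then obtain \<phi> where phi: "\<phi> \<in> X_bc B" "\<phi> \<noteq> 0" "- Laplacian \<phi> = lam k *\<^sub>R \<phi>"
    by (auto simp: eigenvalues_def)
  from phi(3) have eq: "Laplacian \<phi> = (- lam k) *\<^sub>R \<phi>"
    by (metis minus_equation_iff scaleR_minus_left)
  show ?thesis
  proof (rule dim_unique)
    have "\<phi> \<in> null_space ((\<lambda>v. v + lam k *\<^sub>R Laplacian_inv B v) ^^ 1)"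
      using eigenfunction_in_null_space[OF phi(1,2) eq] by (simp add: null_space_def)
    then show "{\<phi>} \<subseteq> (\<Union>j\<in>{1..}. null_space ((\<lambda>v. v + lam k *\<^sub>R Laplacian_inv B v) ^^ j))"
      by blast
    show "(\<Union>j\<in>{1..}. null_space ((\<lambda>v. v + lam k *\<^sub>R Laplacian_inv B v) ^^ j)) \<subseteq> span {\<phi>}"
      using null_space_powers[OF phi(1,2) eq] by blast
    show "independent {\<phi>}" using phi(2) by simp
    show "card {\<phi>} = 1" by simp
  qed
qed

end
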